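(* Let $E_4=\{w0^{\omega},\ w(01)^{\omega} : w\in\{0,1\}^{*}\}$ (the set of $\xi\in\{0,1\}^\omega$ for which the Schreier graph $\Gamma_\xi$ of the Basilica group has four ends). If $\xi\in E_4$, then $\Gamma_\xi$ is isomorphic, as an unrooted graph, to the graph $\Gamma_{(4)}$ described in the context.
   Context: The Basilica group $B=\langle a,b\rangle$ acts on finite and infinite binary words by $a(0w)=0\,b(w)$, $a(1w)=1w$, $b(0w)=1\,a(w)$, $b(1w)=0w$. For $n\ge1$, $\Gamma_n$ is the undirected multigraph with vertex set $\{0,1\}^n$ and, for every vertex $x$ and $s\in\{a,b\}$, one edge joining $x$ and $s(x)$ (a loop if $s(x)=x$; parallel edges allowed; a loop contributes 2 to the degree). For $\xi\in\{0,1\}^\omega$, $\Gamma_\xi$ is defined in the same way on the vertex set $B\cdot\xi$. Labels are forgotten. The $k$-decoration ($k\ge1$) is the following graph $\mathcal D(0^k)$. For $k=1$ it is a single vertex with a loop (the vertex $0$ of $\Gamma_1$ with its loop). For $k\ge2$, removing the vertex $0^k$ from $\Gamma_k$ leaves exactly two connected components; let $U$ be the one not containing $0^{k-1}1$; then $\mathcal D(0^k)$ is the subgraph of $\Gamma_k$ induced by $V(U)\cup\{0^k\}$. In each $k$-decoration the vertex $0^k$ is the unique vertex of degree 2. The graph $\Gamma_{(4)}$: take two copies $\mathcal R_1,\mathcal R_2$ of the bi-infinite path with vertex set $\mathbb Z$ (consecutive integers joined by one edge), and identify the two vertices $0$. For $k\ge0$ let $A_k=\{n\in\mathbb Z : n\equiv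 2^k \bmod 2^{k+1}\}$. For every $k\ge0$, to each vertex of $A_k$ in $\mathcal R_1$ attach a $(2k+1)$-decoration, and to each vertex of $A_k$ in $\mathcal R_2$ attach a $(2k+2)$-decoration, in each case by identifying the vertex with the unique vertex of degree 2 of the decoration. *)

theory Defs
  imports
    "HOL-Library.Stream"
    "HOL-Library.Uprod"
    "HOL-Number_Theory.Cong"
    "HOL-Algebra.Bij"
    "HOL-Algebra.Generated_Groups"
begin

section \<open>The Basilica group and its action on binary words\<close>

text \<open>The letters 0 and 1 are \<open>False\<close> and \<open>True\<close>.\<close>

datatype gen = Ga | Gb

fun act :: "gen \<Rightarrow> bool list \<Rightarrow> bool list" where
  "act g [] = []"
| "act Ga (False # w) = False # act Gb w"
| "act Ga (True # w) = True # w"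
| "act Gb (False # w) = True # act Ga w"
| "act Gb (True # w) = False # w"

primcorec sact :: "gen \<Rightarrow> bool stream \<Rightarrow> bool stream" where
  "sact g s = (if g = Ga
     then (if shd s then True ## stl s else False ## sact Gb (stl s))
     else (if shd s then False ## stl s else True ## sact Ga (stl s)))"

lemma sact_SCons:
  "sact Ga (False ## w) = False ## sact Gb w"
  "sact Ga (True ## w) = True ## w"
  "sact Gb (False ## w) = True ## sact Ga w"
  "sact Gb (True ## w) = False ## w"
  by (subst sact.code; simp)+

primcorec sact_inv :: "gen \<Rightarrow> bool stream \<Rightarrow> bool stream" where
  "sact_inv g s = (if g = Ga
     then (if shd s then True ## stl s else False ## sact_inv Gb (stl s))
     else (if shd s then False ## sact_inv Ga (stl s) else True ## stl s))"

lemma sact_inv_sact: "sact_inv g (sact g s) = s"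
proof (coinduction arbitrary: g s rule: stream.coinduct_strong)
  case Eq_stream
  then show ?case by (cases g; cases "shd s") auto
qed

lemma sact_sact_inv: "sact g (sact_inv g s) = s"
proof (coinduction arbitrary: g s rule: stream.coinduct_strong)
  case Eq_stream
  then show ?case by (cases g; cases "shd s") auto
qed

lemma bij_sact: "bij (sact g)"
  by (rule o_bij[of "sact_inv g"]) (simp_all add: fun_eq_iff sact_inv_sact sact_sact_inv)

text \<open>The Basilica group, as a group of permutations of the infinite binary words.\<close>

definition basilica :: "(bool stream \<Rightarrow> bool stream) set" where
  "basilica = generate (BijGroup UNIV) (range sact)"

definition basilica_orbit :: "bool stream \<Rightarrow> bool stream set" where
  "basilica_orbit \<xi> = (\<lambda>g. g \<xi>) ` basilica"


section \<open>Undirected multigraphs\<close>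

text \<open>An edge \<open>e\<close> with \<open>ends G e = Upair x x\<close> is a loop; distinct edges may have the
  same ends.\<close>

record ('v, 'e) mgraph =
  verts :: "'v set"
  edges :: "'e set"
  ends :: "'e \<Rightarrow> 'v uprod"

definition mgraph_iso :: "('v, 'e) mgraph \<Rightarrow> ('w, 'f) mgraph \<Rightarrow> bool" where
  "mgraph_iso G H \<longleftrightarrow> (\<exists>\<phi> \<psi>. bij_betw \<phi> (verts G) (verts H) \<and> bij_betw \<psi> (edges G) (edges H) \<and>
     (\<forall>e\<in>edges G. ends H (\<psi> e) = map_uprod \<phi> (ends G e)))"

definition induced :: "('v, 'e) mgraph \<Rightarrow> 'v set \<Rightarrow> ('v, 'e) mgraph" where
  "induced G W = \<lparr>verts = W, edges = {e \<in> edges G. set_uprod (ends G e) \<subseteq> W}, ends = ends G\<rparr>"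

definition delete_vertex :: "('v, 'e) mgraph \<Rightarrow> 'v \<Rightarrow> ('v, 'e) mgraph" where
  "delete_vertex G v = induced G (verts G - {v})"

definition adjacency :: "('v, 'e) mgraph \<Rightarrow> ('v \<times> 'v) set" where
  "adjacency G = {(u, v). \<exists>e\<in>edges G. ends G e = Upair u v}"

definition components :: "('v, 'e) mgraph \<Rightarrow> 'v set set" where
  "components G = verts G // (adjacency G)\<^sup>*"


section \<open>Schreier graphs\<close>

text \<open>The edge contributed by the vertex \<open>x\<close> and the generator \<open>s\<close> is the pair \<open>(s, x)\<close>.
  Edges keep this name only to distinguish parallel edges: isomorphisms ignore it.\<close>

definition schreier :: "(gen \<Rightarrow> 'w \<Rightarrow> 'w) \<Rightarrow> 'w set \<Rightarrow> ('w, gen \<times> 'w) mgraph" where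
  "schreier f X = \<lparr>verts = X, edges = UNIV \<times> X, ends = (\<lambda>(s, x). Upair x (f s x))\<rparr>"

definition Gamma_fin :: "nat \<Rightarrow> (bool list, gen \<times> bool list) mgraph" where
  "Gamma_fin n = schreier act {w. length w = n}"

definition Gamma_inf :: "bool stream \<Rightarrow> (bool stream, gen \<times> bool stream) mgraph" where
  "Gamma_inf \<xi> = schreier sact (basilica_orbit \<xi>)"


section \<open>Decorations\<close>

text \<open>Only \<open>k \<ge> 1\<close> is meaningful. For \<open>k = 1\<close> the induced subgraph on the vertex \<open>0\<close> is
  that vertex with its loop.\<close>

definition zeros :: "nat \<Rightarrow> bool list" where
  "zeros k = replicate k False"

definition decoration_part :: "nat \<Rightarrow> bool list set" where
  "decoration_part k = (THE U. U \<in> components (delete_vertex (Gamma_fin k) (zeros k)) \<and>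
     zeros (k - 1) @ [True] \<notin> U)"

definition decoration :: "nat \<Rightarrow> (bool list, gen \<times> bool list) mgraph" where
  "decoration k = induced (Gamma_fin k)
     (if k = 1 then {zeros 1} else decoration_part k \<union> {zeros k})"


section \<open>The graph \<open>\<Gamma>\<^bsub>(4)\<^esub>\<close>\<close>

datatype copy = R1 | R2

definition A :: "nat \<Rightarrow> int set" where
  "A k = {n. [n = 2 ^ k] (mod 2 ^ (k + 1))}"

fun deco_index :: "copy \<Rightarrow> nat \<Rightarrow> nat" where
  "deco_index R1 k = 2 * k + 1"
| "deco_index R2 k = 2 * k + 2"

text \<open>\<open>Hang c k n w\<close> is the vertex \<open>w\<close> of the decoration attached to the
  vertex \<open>n \<in> A k\<close> of the path \<open>c\<close>. The two identifications are carried out by \<open>path_vertex\<close>, which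
  merges the two vertices \<open>0\<close>, and by \<open>deco_vertex\<close>, which merges the degree 2 vertex
  \<open>0\<^sup>k\<close> of a decoration with the path vertex it is attached to; constructor terms
  outside the ranges of these maps are not vertices.\<close>

datatype vertex4 = Origin | Path copy int | Hang copy nat int "bool list"

datatype edge4 = PathEdge copy int | DecoEdge copy nat int "gen \<times> bool list"

definition path_vertex :: "copy \<Rightarrow> int \<Rightarrow> vertex4" where
  "path_vertex c n = (if n = 0 then Origin else Path c n)"

definition deco_vertex :: "copy \<Rightarrow> nat \<Rightarrow> int \<Rightarrow> bool list \<Rightarrow> vertex4" where
  "deco_vertex c k n w =
     (if w = zeros (deco_index c k) then path_vertex c n else Hang c k n w)"

fun ends4 :: "edge4 \<Rightarrow> vertex4 uprod" where
  "ends4 (PathEdge c n) = Upair (path_vertex c n) (path_vertex c (n + 1))"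
| "ends4 (DecoEdge c k n e) =
     map_uprod (deco_vertex c k n) (ends (decoration (deco_index c k)) e)"

definition Gamma4 :: "(vertex4, edge4) mgraph" where
  "Gamma4 = \<lparr>
     verts = {path_vertex c n | c n. True} \<union>
       {deco_vertex c k n w | c k n w. n \<in> A k \<and> w \<in> verts (decoration (deco_index c k))},
     edges = {PathEdge c n | c n. True} \<union>
       {DecoEdge c k n e | c k n e. n \<in> A k \<and> e \<in> edges (decoration (deco_index c k))},
     ends = ends4\<rparr>"


definition E4 :: "bool stream set" where
  "E4 = {w @- sconst False | w. True} \<union> {w @- cycle [False, True] | w. True}"

end

theory Submission
  imports Defs
begin

text \<open>
  Since \<open>b\<^sup>2 (c w) = c a(w)\<close> and \<open>a (0 w) = 0 b(w)\<close>, linking two words by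
  generators also links the words obtained by putting a letter in front of each; together with
  \<open>a (0\<^sup>\<omega>) = (01)\<^sup>\<omega>\<close> this makes \<open>E4\<close> a single orbit
  (\<open>basilica_orbit_E4\<close>). So there is only one graph to identify, and it is seen from
  \<open>0\<^sup>\<omega>\<close>.

  The orbits of \<open>0\<^sup>\<omega>\<close> under \<open>b\<close> and under \<open>a\<close> are the two paths:
  \<open>b\<^sup>2 (0 w) = 0 a(w)\<close> lets \<open>b\<close> and \<open>a\<close> count in binary on every second letter, so the
  vertex with number \<open>n\<close> is the binary expansion of \<open>n\<close> interleaved with zeros. If
  \<open>n \<in> A k\<close>, the first 1 in it comes after \<open>2k\<close> letters on the path of \<open>b\<close> and after
  \<open>2k + 1\<close> letters on the path of \<open>a\<close> (\<open>axis_A\<close>); in both cases the number of leading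
  zeros is one less than the index of the decoration that belongs there.

  In \<open>\<Gamma>\<^sub>k\<close> minus \<open>0\<^sup>k\<close> the parity of the number of trailing zeros of a word is
  constant on components and distinguishes the two of them, and \<open>0\<^bsup>k-1\<^esup>1\<close> has
  an even number of them; hence the decoration consists of \<open>0\<^sup>k\<close> and the words with an odd
  number of trailing zeros (\<open>verts_decoration\<close>). All these words end in 0. Let
  \<open>0\<^bsup>k-1\<^esup>1u\<close> be a path vertex. Then \<open>v0 \<mapsto> v1u\<close> embeds the decoration, because
  a generator that reads \<open>v\<close> and is still active at the last letter must have met
  \<open>v = 0\<^bsup>k-1\<^esup>\<close>, and inside the decoration it then arrives there as \<open>a\<close>, which fixes
  both \<open>0\<close> and \<open>1u\<close> (\<open>place_deco_edge\<close>).

  Every word of \<open>E4\<close> is reached exactly once in this way. The ones of a path vertex all sit at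
  positions of one parity; in every other word of \<open>E4\<close> the last place where two consecutive
  ones have positions of different parities tells where \<open>v\<close> ends (\<open>bij_betw_place\<close>).
  Finally, on both sides an edge is the same thing as a generator together with a source vertex
  (\<open>bij_betw_source\<close>), so the bijection of the vertices determines that of the edges.
\<close>

section \<open>The two sides of the zero vertex in the finite graphs\<close>

text \<open>The trail is the block of zeros after the last 1. The recursion strips the first letter, as
  the action does, so that the two fit together in inductions; a word without a 1 has no trail.\<close>

fun odd_trail :: "bool list \<Rightarrow> bool" where
  "odd_trail [] = False"
| "odd_trail (c # w) = (if True \<in> set w then odd_trail w else c \<and> odd (length w))"

lemma length_zeros [simp]: "length (zeros n) = n"
  and set_zeros_no_True [simp]: "True \<notin> set (zeros n)"
  by (auto simp: zeros_def)

lemma zeros_Suc: "zeros (Suc n) = False # zeros n"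
  by (simp add: zeros_def)

lemma zeros_snoc: "zeros n @ [False] = zeros (Suc n)"
  by (simp add: zeros_def replicate_append_same)

lemma no_True_eq_zeros: "True \<notin> set w \<longleftrightarrow> w = zeros (length w)"
  by (induction w) (auto simp: zeros_def)

lemma has_True_iff: "length w = n \<Longrightarrow> True \<in> set w \<longleftrightarrow> w \<noteq> zeros n"
  using no_True_eq_zeros by metis

lemma odd_trail_has_True: "odd_trail w \<Longrightarrow> True \<in> set w"
  by (induction w) (auto split: if_splits)

lemma odd_trail_snoc: "odd_trail (w @ [c]) \<longleftrightarrow> \<not> c \<and> True \<in> set w \<and> \<not> odd_trail w"
  by (induction w) (auto dest: odd_trail_has_True)

lemma odd_trail_last_one:
  "odd_trail w \<Longrightarrow> \<exists>p<length w. w ! p \<and> even (length w - p) \<and> (\<forall>i<length w. p < i \<longrightarrow> \<not> w ! i)"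
proof (induction w)
  case (Cons c w)
  show ?case
  proof (cases "True \<in> set w")
    case True
    then obtain p where "p < length w" "w ! p" "even (length w - p)" "\<forall>i<length w. p < i \<longrightarrow> \<not> w ! i"
      using Cons by auto
    then show ?thesis
      by (intro exI[of _ "Suc p"]) (auto simp: nth_Cons split: nat.splits)
  next
    case False
    then show ?thesis
      using Cons.prems by (intro exI[of _ 0]) (auto simp: nth_Cons split: nat.splits dest: nth_mem)
  qed
qed simp

lemma length_act [simp]: "length (act s w) = length w"
  by (induction s w rule: act.induct) auto

fun swap_gen :: "gen \<Rightarrow> gen" where
  "swap_gen Ga = Gb"
| "swap_gen Gb = Ga"

text \<open>The generator whose edges at \<open>0\<^sup>n\<close> stay within the decoration: read along
  \<open>0\<^bsup>n-1\<^esup>\<close>, it reaches the last letter as \<open>a\<close> and leaves it unchanged. The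
  other generator arrives as \<open>b\<close>.\<close>

definition inner_gen :: "nat \<Rightarrow> gen" where
  "inner_gen n = (if odd n then Ga else Gb)"

lemma act_zeros_odd_trail:
  "True \<in> set (act s (zeros n)) \<Longrightarrow> odd_trail (act s (zeros n)) \<longleftrightarrow> s = inner_gen n"
proof (induction n arbitrary: s)
  case (Suc n)
  have *: "True \<notin> set (act Ga (zeros n)) \<Longrightarrow> n \<le> 1"
    by (cases n rule: nat.exhaust; cases "n - 1") (auto simp: zeros_Suc)
  have **: "True \<notin> set (act Gb (zeros n)) \<Longrightarrow> n = 0"
    by (cases n) (auto simp: zeros_Suc)
  show ?case
    using Suc * ** by (cases s) (auto simp: zeros_Suc inner_gen_def le_Suc_eq split: if_splits)
qed (simp add: zeros_def)

text \<open>The only candidates for \<open>w\<close> are \<open>010\<dots>0\<close> for \<open>a\<close> and \<open>10\<dots>0\<close> for \<open>b\<close>.\<close>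

lemma odd_trail_zeros_preimage:
  "True \<in> set w \<Longrightarrow> True \<notin> set (act s w) \<Longrightarrow> odd_trail w \<longleftrightarrow> s = inner_gen (length w)"
  by (induction s w rule: act.induct) (auto simp: inner_gen_def split: if_splits)

text \<open>The action stops at the first 1, so the trail can only change if this 1 is also the last one
  and is erased. Then zeros alone are left behind the letters changed before it, and
  \<open>odd_trail_zeros_preimage\<close> gives the parity of their number.\<close>

lemma odd_trail_act:
  "True \<in> set w \<Longrightarrow> True \<in> set (act s w) \<Longrightarrow> odd_trail (act s w) \<longleftrightarrow> odd_trail w"
proof (induction s w rule: act.induct)
  case (4 w)
  then show ?case
    using odd_trail_zeros_preimage[of w Ga] by (auto simp: inner_gen_def split: if_splits)
qed (auto split: if_splits)

text \<open>A generator goes on to the next letter only after reading a 0, so the first 1 stops it.\<close>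

lemma act_append:
  "True \<in> set w \<Longrightarrow> act s (w @ v) = act s w @ v"
  by (induction s w rule: act.induct) auto

lemma act_zeros_append:
  "act s (zeros n @ v) = act s (zeros n) @ act (if even n then s else swap_gen s) v"
proof (induction n arbitrary: s)
  case (Suc n)
  then show ?case by (cases s) (auto simp: zeros_Suc)
qed (simp add: zeros_def)

lemma zeros_has_preimage:
  assumes "n \<ge> 2"
  obtains w where "length w = n" "True \<in> set w" "act s w = zeros n"
proof -
  obtain m where n: "n = Suc (Suc m)"
    using assms by (metis add_2_eq_Suc le_Suc_ex)
  show ?thesis
  proof (cases s)
    case Ga
    then show ?thesis by (intro that[of "False # True # zeros m"]) (auto simp: n zeros_Suc)
  next
    case Gb
    then show ?thesis by (intro that[of "True # zeros (Suc m)"]) (auto simp: n zeros_Suc)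
  qed
qed

lemma act_zeros_nonzero:
  "n \<ge> 2 \<Longrightarrow> True \<in> set (act s (zeros n))"
  by (cases n; cases "n - 1"; cases s) (auto simp: zeros_Suc)

abbreviation punctured :: "nat \<Rightarrow> (bool list \<times> bool list) set" where
  "punctured n \<equiv> adjacency (delete_vertex (Gamma_fin n) (zeros n))"

lemma punctured_iff:
  "(u, v) \<in> punctured n \<longleftrightarrow> length u = n \<and> length v = n \<and> True \<in> set u \<and> True \<in> set v \<and>
     (\<exists>s. act s u = v \<or> act s v = u)"
proof -
  have "(u, v) \<in> punctured n \<longleftrightarrow> (\<exists>s x. length x = n \<and> x \<noteq> zeros n \<and> act s x \<noteq> zeros n \<and>
      Upair x (act s x) = Upair u v)"
    by (simp add: adjacency_def delete_vertex_def induced_def Gamma_fin_def schreier_def) blast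
  also have "\<dots> \<longleftrightarrow> (\<exists>s x. length x = n \<and> True \<in> set x \<and> True \<in> set (act s x) \<and>
      Upair x (act s x) = Upair u v)"
    by (metis length_act has_True_iff)
  also have "\<dots> \<longleftrightarrow> length u = n \<and> length v = n \<and> True \<in> set u \<and> True \<in> set v \<and>
      (\<exists>s. act s u = v \<or> act s v = u)"
    unfolding Upair_inject by (metis length_act)
  finally show ?thesis .
qed

lemma punctured_rtrancl_sym: "(u, v) \<in> (punctured n)\<^sup>* \<Longrightarrow> (v, u) \<in> (punctured n)\<^sup>*"
  by (rule symD[OF sym_rtrancl]) (auto simp: sym_def punctured_iff)

lemma punctured_rtrancl_inv:
  assumes "(u, v) \<in> (punctured n)\<^sup>*" "length u = n" "True \<in> set u"
  shows "length v = n \<and> True \<in> set v \<and> (odd_trail v \<longleftrightarrow> odd_trail u)"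
  using assms
proof (induction rule: rtrancl_induct)
  case (step y z)
  then show ?case
    using odd_trail_act[of y] odd_trail_act[of z] unfolding punctured_iff by auto
qed simp

lemma punctured_rtrancl_snoc:
  assumes "(u, v) \<in> (punctured n)\<^sup>*"
  shows "(u @ [c], v @ [c]) \<in> (punctured (Suc n))\<^sup>*"
  using assms
proof (induction rule: rtrancl_induct)
  case (step y z)
  have "(y @ [c], z @ [c]) \<in> punctured (Suc n)"
    using step.hyps(2) unfolding punctured_iff by (auto simp: act_append)
  with step.IH show ?case by (rule rtrancl_into_rtrancl)
qed simp

text \<open>\<open>\<Gamma>\<^bsub>n+1\<^esub>\<close> consists of two copies of \<open>\<Gamma>\<^sub>n\<close>, one for each last letter, in
  which only the edge out of \<open>0\<^sup>n\<close> labelled \<open>inner_gen n\<close> is redirected to the other copy.\<close>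

lemma act_inner_zeros_snoc:
  "act (inner_gen n) (zeros n @ [c]) = act (inner_gen n) (zeros n) @ [\<not> c]"
  "act (swap_gen (inner_gen n)) (zeros n @ [c]) = act (swap_gen (inner_gen n)) (zeros n) @ [c]"
  by (cases c; simp add: act_zeros_append inner_gen_def)+

text \<open>Induction along the two copies of \<open>\<Gamma>\<^sub>n\<close> in \<open>\<Gamma>\<^bsub>n+1\<^esub>\<close>. The words with an odd number of
  trailing zeros are \<open>x0\<close> with \<open>x\<close> of even trail, a copy of a side that is connected
  already. The remaining words are the whole copy that ends in 1 and the odd side of the copy that
  ends in 0; all of them are joined to \<open>0\<^sup>n1\<close>.\<close>

lemma punctured_connected:
  assumes "length u = n" "length v = n" "True \<in> set u" "True \<in> set v"
    and "odd_trail u \<longleftrightarrow> odd_trail v"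
  shows "(u, v) \<in> (punctured n)\<^sup>*"
  using assms
proof (induction n arbitrary: u v)
  case (Suc n)
  let ?z = "zeros n" and ?i = "inner_gen n" and ?o = "swap_gen (inner_gen n)"
  have hub: "(w, ?z @ [True]) \<in> (punctured (Suc n))\<^sup>*"
    if w: "length w = Suc n" "True \<in> set w" "\<not> odd_trail w" for w
  proof -
    obtain x c where xc: "w = x @ [c]" "length x = n"
      using w(1) by (metis length_Suc_conv_rev)
    show ?thesis
    proof (cases "True \<in> set x")
      case False
      with w xc show ?thesis using no_True_eq_zeros[of x] by (cases c) auto
    next
      case True
      with xc(2) have n: "n \<ge> 1" by (cases x) auto
      show ?thesis
      proof (cases "odd_trail x")
        case odd: True
        then have n2: "n \<ge> 2"
          using xc(2) n by (cases x; cases "tl x") (auto split: if_splits)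
        show ?thesis
        proof (cases c)
          case c: True
          \<comment> \<open>the edge into \<open>0\<^sup>n\<close> labelled \<open>?i\<close> is not redirected, and it starts on the odd side\<close>
          obtain y where y: "length y = n" "True \<in> set y" "act ?i y = ?z"
            using zeros_has_preimage[OF n2] .
          then have "odd_trail y"
            using odd_trail_zeros_preimage[of y ?i] by simp
          with odd have "(x, y) \<in> (punctured n)\<^sup>*"
            using Suc.IH xc y True by simp
          then have "(w, y @ [True]) \<in> (punctured (Suc n))\<^sup>*"
            using punctured_rtrancl_snoc xc c by auto
          moreover have "(y @ [True], ?z @ [True]) \<in> punctured (Suc n)"
            using y by (auto simp: punctured_iff act_append intro!: exI[of _ ?i])
          ultimately show ?thesis by (rule rtrancl_into_rtrancl)
        next
          case c: False
          \<comment> \<open>here the redirected edge leads from \<open>0\<^sup>n1\<close> to the odd side of the copy that ends in 0\<close>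
          have "(x, act ?i ?z) \<in> (punctured n)\<^sup>*"
            using Suc.IH xc True odd act_zeros_nonzero[OF n2] act_zeros_odd_trail by simp
          then have "(w, act ?i ?z @ [False]) \<in> (punctured (Suc n))\<^sup>*"
            using punctured_rtrancl_snoc xc c by auto
          moreover have "(act ?i ?z @ [False], ?z @ [True]) \<in> punctured (Suc n)"
            using act_zeros_nonzero[OF n2]
            by (auto simp: punctured_iff act_inner_zeros_snoc intro!: exI[of _ ?i])
          ultimately show ?thesis by (rule rtrancl_into_rtrancl)
        qed
      next
        case even: False
        with w xc True have c: "c" by (auto simp: odd_trail_snoc)
        \<comment> \<open>the edge out of \<open>0\<^sup>n\<close> labelled \<open>?o\<close> ends on the even side and survives in the copy that ends in 1\<close>
        have nz: "True \<in> set (act ?o ?z)"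
        proof (cases "n \<ge> 2")
          case False
          with n have "n = 1" by simp
          then show ?thesis by (simp add: inner_gen_def zeros_def)
        qed (rule act_zeros_nonzero)
        have "?o \<noteq> ?i" by (simp add: inner_gen_def)
        then have "(x, act ?o ?z) \<in> (punctured n)\<^sup>*"
          using Suc.IH xc True even nz act_zeros_odd_trail by simp
        then have "(w, act ?o ?z @ [True]) \<in> (punctured (Suc n))\<^sup>*"
          using punctured_rtrancl_snoc xc c by auto
        moreover have "(act ?o ?z @ [True], ?z @ [True]) \<in> punctured (Suc n)"
          using nz by (auto simp: punctured_iff act_inner_zeros_snoc intro!: exI[of _ ?o])
        ultimately show ?thesis by (rule rtrancl_into_rtrancl)
      qed
    qed
  qed
  show ?case
  proof (cases "odd_trail u")
    case True
    obtain x c y d where "u = x @ [c]" "length x = n" "v = y @ [d]" "length y = n"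
      using Suc.prems by (metis length_Suc_conv_rev)
    with True Suc.prems(5) show ?thesis
      using punctured_rtrancl_snoc[OF Suc.IH[of x y], of False] by (auto simp: odd_trail_snoc)
  next
    case False
    with Suc.prems show ?thesis
      using hub[of u] hub[of v] by (metis punctured_rtrancl_sym rtrancl_trans)
  qed
qed simp

lemma components_punctured:
  "components (delete_vertex (Gamma_fin n) (zeros n)) =
     {{v. length v = n \<and> True \<in> set v \<and> odd_trail v = odd_trail u} | u. length u = n \<and> True \<in> set u}"
proof -
  have verts: "verts (delete_vertex (Gamma_fin n) (zeros n)) = {u. length u = n \<and> True \<in> set u}"
    by (auto simp: delete_vertex_def induced_def Gamma_fin_def schreier_def has_True_iff)
  have class_eq: "(punctured n)\<^sup>* `` {u} = {v. length v = n \<and> True \<in> set v \<and> odd_trail v = odd_trail u}"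
    if u: "u \<in> {u. length u = n \<and> True \<in> set u}" for u
  proof (intro equalityI subsetI)
    fix v
    assume "v \<in> (punctured n)\<^sup>* `` {u}"
    then show "v \<in> {v. length v = n \<and> True \<in> set v \<and> odd_trail v = odd_trail u}"
      using punctured_rtrancl_inv[of u v n] u by simp
  next
    fix v
    assume "v \<in> {v. length v = n \<and> True \<in> set v \<and> odd_trail v = odd_trail u}"
    then show "v \<in> (punctured n)\<^sup>* `` {u}"
      using punctured_connected[of u n v] u by simp
  qed
  have "components (delete_vertex (Gamma_fin n) (zeros n)) =
      (\<lambda>u. (punctured n)\<^sup>* `` {u}) ` {u. length u = n \<and> True \<in> set u}"
    unfolding components_def quotient_def verts by (rule UNION_singleton_eq_range)
  also have "\<dots> = (\<lambda>u. {v. length v = n \<and> True \<in> set v \<and> odd_trail v = odd_trail u}) `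
      {u. length u = n \<and> True \<in> set u}"
    by (rule image_cong[OF refl class_eq])
  finally show ?thesis by (simp only: setcompr_eq_image)
qed

lemma decoration_part_eq:
  assumes "k \<ge> 2"
  shows "decoration_part k = {w. length w = k \<and> odd_trail w}"
  unfolding decoration_part_def components_punctured
proof (rule the_equality)
  obtain m where k: "k = Suc (Suc m)"
    using assms by (metis add_2_eq_Suc le_Suc_ex)
  let ?u = "(zeros m @ [True]) @ [False]"
  have u: "length ?u = k" "True \<in> set ?u" "odd_trail ?u"
    by (auto simp: k odd_trail_snoc simp del: append_assoc)
  then have "{w. length w = k \<and> odd_trail w} =
      {v. length v = k \<and> True \<in> set v \<and> odd_trail v = odd_trail ?u}"
    by (intro Collect_cong) (auto simp: odd_trail_has_True simp del: append_assoc)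
  moreover have "zeros (k - 1) @ [True] \<notin> {w. length w = k \<and> odd_trail w}"
    by (simp add: odd_trail_snoc)
  ultimately show "{w. length w = k \<and> odd_trail w} \<in>
      {{v. length v = k \<and> True \<in> set v \<and> odd_trail v = odd_trail u} | u. length u = k \<and> True \<in> set u} \<and>
      zeros (k - 1) @ [True] \<notin> {w. length w = k \<and> odd_trail w}"
    using u(1,2) by blast
next
  fix U
  assume "U \<in> {{v. length v = k \<and> True \<in> set v \<and> odd_trail v = odd_trail u} | u. length u = k \<and> True \<in> set u} \<and>
      zeros (k - 1) @ [True] \<notin> U"
  then obtain u where U: "U = {v. length v = k \<and> True \<in> set v \<and> odd_trail v = odd_trail u}"
    and out: "zeros (k - 1) @ [True] \<notin> U" by blast
  have "odd_trail u"
    using out assms by (auto simp: U odd_trail_snoc)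
  then show "U = {w. length w = k \<and> odd_trail w}"
    by (auto simp: U odd_trail_has_True)
qed

definition deco_words :: "nat \<Rightarrow> bool list set" where
  "deco_words k = {w. length w = k \<and> (True \<in> set w \<longrightarrow> odd_trail w)}"

lemma zeros_in_deco_words [simp]: "zeros k \<in> deco_words k"
  by (simp add: deco_words_def)

lemma verts_decoration:
  assumes "k \<ge> 1"
  shows "verts (decoration k) = deco_words k"
proof (cases "k = 1")
  case True
  then show ?thesis
    by (auto simp: decoration_def induced_def deco_words_def zeros_def length_Suc_conv)
next
  case False
  with assms have "decoration_part k = {w. length w = k \<and> odd_trail w}"
    by (intro decoration_part_eq) simp
  moreover have "deco_words k = {w. length w = k \<and> odd_trail w} \<union> {zeros k}"
  proof (intro equalityI subsetI)
    fix w
    assume "w \<in> deco_words k"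
    then show "w \<in> {w. length w = k \<and> odd_trail w} \<union> {zeros k}"
      using has_True_iff[of w k] by (cases "w = zeros k") (simp_all add: deco_words_def)
  next
    fix w
    assume "w \<in> {w. length w = k \<and> odd_trail w} \<union> {zeros k}"
    then show "w \<in> deco_words k"
      by (elim UnE) (simp_all add: deco_words_def)
  qed
  ultimately show ?thesis
    using False by (simp add: decoration_def induced_def)
qed

lemma ends_decoration: "ends (decoration k) (s, w) = Upair w (act s w)"
  by (simp add: decoration_def induced_def Gamma_fin_def schreier_def)

text \<open>Of all edges that start in the decoration, only the one out of \<open>0\<^sup>k\<close> labelled by the
  generator other than \<open>inner_gen k\<close> ends outside.\<close>

lemma edges_decoration:
  assumes "k \<ge> 1"
  shows "edges (decoration k) = {(s, w). w \<in> deco_words k \<and> (True \<in> set w \<or> s = inner_gen k)}"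
proof -
  have "act s w \<in> deco_words k \<longleftrightarrow> True \<in> set w \<or> s = inner_gen k" if w: "w \<in> deco_words k" for s w
  proof (cases "True \<in> set w")
    case True
    then show ?thesis using w odd_trail_act[of w s] by (auto simp: deco_words_def)
  next
    case False
    then have wz: "w = zeros k"
      using w has_True_iff[of w k] by (simp add: deco_words_def)
    show ?thesis
    proof (cases "True \<in> set (act s w)")
      case True
      then show ?thesis using wz act_zeros_odd_trail[of s k] by (simp add: deco_words_def)
    next
      case zero: False
      have "s = inner_gen k"
      proof (rule ccontr)
        assume "s \<noteq> inner_gen k"
        then have "True \<in> set (act s (zeros k))"
          using assms act_zeros_nonzero[of k s]
          by (cases "k = 1"; cases s) (auto simp: inner_gen_def zeros_def)
        with zero wz show False by simp
      qed
      with zero wz show ?thesis by (simp add: deco_words_def)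
    qed
  qed
  moreover have "edges (decoration k) =
      {e \<in> edges (Gamma_fin k). set_uprod (ends (Gamma_fin k) e) \<subseteq> verts (decoration k)}"
    by (simp add: decoration_def induced_def)
  then have "edges (decoration k) = {(s, w). w \<in> deco_words k \<and> act s w \<in> deco_words k}"
    unfolding verts_decoration[OF assms]
    by (auto simp: Gamma_fin_def schreier_def deco_words_def)
  ultimately show ?thesis by auto
qed


section \<open>The two axes\<close>

text \<open>The word \<open>axis R1 n\<close> is \<open>b\<^bsup>-n\<^esup> (0\<^sup>\<omega>)\<close>: the binary digits of \<open>n\<close>, least significant
  first and in two's complement if \<open>n < 0\<close>, each followed by a 0. The word \<open>axis R2 n\<close> is
  \<open>a\<^bsup>-n\<^esup> (0\<^sup>\<omega>)\<close>. Negative exponents keep the digits those of \<open>n\<close> itself.\<close>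

primcorec axis :: "copy \<Rightarrow> int \<Rightarrow> bool stream" where
  "shd (axis c n) = (c = R1 \<and> odd n)"
| "stl (axis c n) = (if c = R1 then axis R2 (n div 2) else axis R1 n)"

lemma axis_SCons:
  "axis R1 n = odd n ## axis R2 (n div 2)"
  "axis R2 n = False ## axis R1 n"
  by (rule stream.expand, simp)+

lemma axis_zero: "axis c 0 = sconst False"
  by (coinduction arbitrary: c rule: stream.coinduct) auto

lemma axis_minus_one: "axis c (- 1) = cycle (if c = R1 then [True, False] else [False, True])"
proof -
  have "cycle [True, False] = True ## cycle [False, True]"
    by (subst cycle_Cons) simp
  moreover have "cycle [False, True] = False ## cycle [True, False]"
    by (subst cycle_Cons) simp
  ultimately have hd_tl: "shd (cycle [True, False])" "stl (cycle [True, False]) = cycle [False, True]"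
    "\<not> shd (cycle [False, True])" "stl (cycle [False, True]) = cycle [True, False]"
    by (metis stream.sel)+
  show ?thesis
    by (coinduction arbitrary: c rule: stream.coinduct) (auto simp: hd_tl)
qed

fun axis_gen :: "copy \<Rightarrow> gen" where
  "axis_gen R1 = Gb"
| "axis_gen R2 = Ga"

text \<open>A carry out of a digit of \<open>axis R1\<close> becomes a step of \<open>a\<close> on the tail, which lies on
  \<open>axis R2\<close>, and \<open>a\<close> passes it on over the interleaved 0 as a step of \<open>b\<close>.\<close>

lemma sact_axis: "sact (axis_gen c) (axis c (n + 1)) = axis c n"
proof (coinduction arbitrary: c n rule: stream.coinduct_strong)
  case Eq_stream
  show ?case
  proof (cases c)
    case R1
    show ?thesis
    proof (cases "odd n")
      case True
      then have "(n + 1) div 2 = n div 2 + 1" by presburger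
      with R1 True show ?thesis by (auto intro!: exI[of _ R2])
    next
      case False
      then have "(n + 1) div 2 = n div 2" by presburger
      with R1 False show ?thesis by auto
    qed
  next
    case R2
    then show ?thesis by (auto intro!: exI[of _ R1])
  qed
qed

lemma A_iff: "n \<in> A k \<longleftrightarrow> (\<exists>m. n = 2 ^ k * (2 * m + 1))"
proof
  assume "n \<in> A k"
  then have "[2 ^ k = n] (mod 2 ^ (k + 1))"
    by (simp add: A_def cong_sym)
  then obtain m where "n = 2 ^ k + 2 ^ (k + 1) * m"
    unfolding cong_iff_lin by blast
  then show "\<exists>m. n = 2 ^ k * (2 * m + 1)"
    by (intro exI[of _ m]) (simp add: algebra_simps)
next
  assume "\<exists>m. n = 2 ^ k * (2 * m + 1)"
  then obtain m where "n = 2 ^ k + 2 ^ (k + 1) * m"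
    by (auto simp: algebra_simps)
  then show "n \<in> A k"
    unfolding A_def using cong_iff_lin cong_sym by blast
qed

lemma A_0: "n \<in> A 0 \<longleftrightarrow> odd n"
  unfolding A_iff by (auto elim: oddE)

lemma A_Suc: "2 * n \<in> A (Suc k) \<longleftrightarrow> n \<in> A k"
  unfolding A_iff by simp

lemma A_Suc_even: "n \<in> A (Suc k) \<Longrightarrow> even n"
  unfolding A_iff by auto

lemma zero_notin_A: "0 \<notin> A k"
proof
  assume "0 \<in> A k"
  then obtain m :: int where "2 * m + 1 = 0" by (auto simp: A_iff)
  then show False by presburger
qed

lemma A_cover:
  assumes "n \<noteq> 0"
  shows "\<exists>k. n \<in> A k"
  using assms
proof (induction "nat \<bar>n\<bar>" arbitrary: n rule: less_induct)
  case less
  show ?case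
  proof (cases "odd n")
    case True
    then show ?thesis using A_0 by blast
  next
    case False
    then obtain m where m: "n = 2 * m" by blast
    with less.prems have "nat \<bar>m\<bar> < nat \<bar>n\<bar>" "m \<noteq> 0" by auto
    then obtain k where "m \<in> A k" using less.hyps by blast
    with m show ?thesis using A_Suc by blast
  qed
qed

lemma A_unique: "n \<in> A j \<Longrightarrow> n \<in> A k \<Longrightarrow> j = k"
proof (induction j arbitrary: n k)
  case 0
  then have "odd n" by (simp add: A_0)
  with 0 show ?case using A_Suc_even[of n] by (cases k) auto
next
  case (Suc j)
  then obtain m where m: "n = 2 * m" using A_Suc_even by blast
  with Suc.prems obtain i where i: "k = Suc i" by (cases k) (simp_all add: A_0)
  have "m \<in> A j" "m \<in> A i" using Suc.prems by (simp_all add: m i A_Suc)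
  with Suc.IH i show ?case by simp
qed

lemma deco_index_pos: "deco_index c k \<ge> 1"
  by (cases c) auto

text \<open>The exponent of 2 in \<open>n\<close> counts the zero digits below the lowest nonzero one, and every digit
  takes two letters; this is where the indices of the decorations come from.\<close>

lemma axis_A:
  assumes "n \<in> A k"
  shows "\<exists>y. axis c n = zeros (deco_index c k - 1) @- True ## y"
proof -
  have R1: "\<exists>y. axis R1 n = zeros (2 * k) @- True ## y"
    using assms
  proof (induction k arbitrary: n)
    case 0
    then show ?case by (simp add: A_0 axis_SCons(1)[of n] zeros_def)
  next
    case (Suc k)
    then obtain m where m: "n = 2 * m" using A_Suc_even by blast
    with Suc.prems have "m \<in> A k" by (simp add: A_Suc)
    then obtain y where "axis R1 m = zeros (2 * k) @- True ## y"
      using Suc.IH by blast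
    then have "axis R1 n = zeros (2 * Suc k) @- True ## y"
      by (simp add: m axis_SCons(1)[of "2 * m"] axis_SCons(2) zeros_Suc)
    then show ?case by blast
  qed
  then show ?thesis by (cases c) (simp_all add: axis_SCons(2) zeros_Suc)
qed

lemma axis_snth_parity: "axis c n !! i \<Longrightarrow> even i \<longleftrightarrow> c = R1"
proof (induction i arbitrary: c n)
  case (Suc i)
  then show ?case by (cases c) (auto split: if_splits)
qed simp

lemma axis_inject: "axis c m = axis c n \<longleftrightarrow> m = n"
proof -
  have R1: "m = n" if "axis R1 m = axis R1 n" for m n
    using that
  proof (induction "nat \<bar>m - n\<bar>" arbitrary: m n rule: less_induct)
    case less
    have par: "odd m \<longleftrightarrow> odd n" and eq: "axis R1 (m div 2) = axis R1 (n div 2)"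
      using arg_cong[OF less.prems, of shd] arg_cong[OF less.prems, of "stl \<circ> stl"] by simp_all
    show ?case
    proof (rule ccontr)
      assume ne: "m \<noteq> n"
      have "m = 2 * (m div 2) + n mod 2" "n = 2 * (n div 2) + n mod 2"
        using par by presburger+
      moreover from this ne have "m div 2 \<noteq> n div 2" by auto
      ultimately have "\<bar>m div 2 - n div 2\<bar> < \<bar>m - n\<bar>" by linarith
      then have "nat \<bar>m div 2 - n div 2\<bar> < nat \<bar>m - n\<bar>" by linarith
      with less.hyps eq have "m div 2 = n div 2" by blast
      with par ne show False by presburger
    qed
  qed
  have "axis R1 m = axis R1 n" if "axis c m = axis c n"
    using that
  proof (cases c)
    case R2
    with that show ?thesis by (simp add: axis_SCons(2))
  qed simp
  with R1 show ?thesis by blast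
qed


section \<open>The set of four-ended words is a single orbit\<close>

lemma E4_sconst: "sconst False \<in> E4"
  and E4_cycle: "cycle [False, True] \<in> E4"
  unfolding E4_def by (metis (mono_tags, lifting) UnI1 UnI2 mem_Collect_eq shift.simps(1))+

lemma E4_shift: "x \<in> E4 \<Longrightarrow> w @- x \<in> E4"
  unfolding E4_def by (auto simp flip: shift_append)

lemma E4_SCons: "x \<in> E4 \<Longrightarrow> c ## x \<in> E4"
  using E4_shift[of x "[c]"] by simp

text \<open>Every property that passes to words with a letter in front need only be checked at the two
  periodic words; this reduces statements on \<open>E4\<close> to the recursion of the action.\<close>

lemma E4_induct [consumes 1, case_names zero alternating SCons]:
  assumes "x \<in> E4" "P (sconst False)" "P (cycle [False, True])"
    and "\<And>c x. x \<in> E4 \<Longrightarrow> P x \<Longrightarrow> P (c ## x)"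
  shows "P x"
proof -
  have "P (w @- y)" if "y \<in> E4" "P y" for w y
    using that by (induction w) (auto intro: assms(4) E4_shift)
  then show ?thesis
    using assms(1-3) E4_sconst E4_cycle by (auto simp: E4_def)
qed

lemma sconst_False_unfold: "sconst False = False ## sconst False"
  by (rule stream.expand) simp

lemma alternating_unfold: "cycle [False, True] = False ## True ## cycle [False, True]"
  using cycle_Cons[of False "[True]"] cycle_Cons[of True "[False]"] by (metis append_Cons append_Nil)

lemma sact_zero: "sact Ga (sconst False) = cycle [False, True]"
  using sact_axis[of R2 "- 1"] by (simp add: axis_zero axis_minus_one)

lemma sact_inv_SCons:
  "sact_inv Ga (False ## w) = False ## sact_inv Gb w"
  "sact_inv Ga (True ## w) = True ## w"
  "sact_inv Gb (False ## w) = True ## w"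
  "sact_inv Gb (True ## w) = False ## sact_inv Ga w"
  by (subst sact_inv.code; simp)+

lemma E4_sact: "x \<in> E4 \<Longrightarrow> sact s x \<in> E4"
proof (induction x arbitrary: s rule: E4_induct)
  case zero
  have "sact Gb (sconst False) = True ## cycle [False, True]"
    by (subst sconst_False_unfold) (simp only: sact_SCons sact_zero)
  then show ?case by (cases s) (simp_all add: sact_zero E4_cycle E4_SCons)
next
  case alternating
  show ?case
    by (subst alternating_unfold, cases s) (simp_all add: sact_SCons E4_cycle E4_SCons)
next
  case (SCons c x)
  then show ?case by (cases s; cases c) (simp_all add: sact_SCons E4_SCons)
qed

lemma E4_sact_inv: "x \<in> E4 \<Longrightarrow> sact_inv s x \<in> E4"
proof (induction x arbitrary: s rule: E4_induct)
  case zero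
  have b_inv: "sact_inv Gb (sconst False) = True ## sconst False"
    by (subst sconst_False_unfold) (simp only: sact_inv_SCons)
  show ?case
  proof (cases s)
    case Ga
    have "sact_inv Ga (sconst False) = False ## sact_inv Gb (sconst False)"
      by (subst sconst_False_unfold) (simp only: sact_inv_SCons)
    with Ga b_inv show ?thesis by (simp only: E4_SCons E4_sconst)
  next
    case Gb
    with b_inv show ?thesis by (simp only: E4_SCons E4_sconst)
  qed
next
  case alternating
  show ?case
  proof (cases s)
    case Ga
    then show ?thesis
      using E4_sconst sact_inv_sact[of Ga "sconst False"] by (simp add: sact_zero)
  next
    case Gb
    then show ?thesis
      by (subst alternating_unfold) (simp add: sact_inv_SCons E4_cycle E4_SCons)
  qed
next
  case (SCons c x)
  then show ?case by (cases s; cases c) (simp_all add: sact_inv_SCons E4_SCons)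
qed

lemma sact_in_Bij: "sact s \<in> Bij UNIV"
  using bij_sact by (auto simp: Bij_def)

lemma basilica_subgroup: "subgroup basilica (BijGroup UNIV)"
  unfolding basilica_def
  by (rule group.generate_is_subgroup[OF group_BijGroup]) (auto simp: BijGroup_def sact_in_Bij)

lemma mult_BijGroup_UNIV: "f \<in> Bij UNIV \<Longrightarrow> g \<in> Bij UNIV \<Longrightarrow> f \<otimes>\<^bsub>BijGroup UNIV\<^esub> g = f \<circ> g"
  by (simp add: BijGroup_def compose_def fun_eq_iff)

lemma inv_sact: "inv\<^bsub>BijGroup UNIV\<^esub> (sact s) = sact_inv s"
  using inv_BijGroup[OF sact_in_Bij] inv_equality[of "sact_inv s" "sact s"]
  by (simp add: sact_inv_sact sact_sact_inv fun_eq_iff)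

lemma basilica_in_Bij: "g \<in> basilica \<Longrightarrow> g \<in> Bij UNIV"
  using subgroup.mem_carrier[OF basilica_subgroup] by (auto simp: BijGroup_def)

lemma basilica_comp: "f \<in> basilica \<Longrightarrow> g \<in> basilica \<Longrightarrow> f \<circ> g \<in> basilica"
  using subgroup.m_closed[OF basilica_subgroup] mult_BijGroup_UNIV basilica_in_Bij by metis

lemma basilica_gens: "sact s \<in> basilica" "sact_inv s \<in> basilica" "id \<in> basilica"
proof -
  show "sact s \<in> basilica"
    unfolding basilica_def by (rule generate.incl) simp
  show "sact_inv s \<in> basilica"
    unfolding basilica_def inv_sact[symmetric] by (rule generate.inv) simp
  show "id \<in> basilica"
    using subgroup.one_closed[OF basilica_subgroup] by (simp add: BijGroup_def id_def restrict_UNIV)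
qed

lemma basilica_preserves_E4:
  assumes "g \<in> basilica"
  shows "g ` E4 \<subseteq> E4"
  using assms unfolding basilica_def
proof (induction rule: generate.induct)
  case one
  then show ?case by (auto simp: BijGroup_def)
next
  case (incl h)
  then show ?case using E4_sact by auto
next
  case (inv h)
  then show ?case using E4_sact_inv by (auto simp: inv_sact)
next
  case (eng g h)
  then have "g \<otimes>\<^bsub>BijGroup UNIV\<^esub> h = g \<circ> h"
    using basilica_in_Bij by (simp add: basilica_def mult_BijGroup_UNIV)
  with eng.IH show ?case by auto
qed

definition sact_steps :: "(bool stream \<times> bool stream) set" where
  "sact_steps = {(x, y). \<exists>s. sact s x = y \<or> sact s y = x}"

lemma sact_steps_sym: "(x, y) \<in> sact_steps\<^sup>* \<Longrightarrow> (y, x) \<in> sact_steps\<^sup>*"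
  by (rule symD[OF sym_rtrancl]) (auto simp: sym_def sact_steps_def)

lemma sact_stepI: "(x, sact s x) \<in> sact_steps"
  by (auto simp: sact_steps_def)

lemma sact_steps_basilica: "(x, y) \<in> sact_steps\<^sup>* \<Longrightarrow> \<exists>g\<in>basilica. g x = y"
proof (induction rule: rtrancl_induct)
  case base
  then show ?case using basilica_gens(3) by (auto intro: bexI[of _ id])
next
  case (step y z)
  then obtain g where g: "g \<in> basilica" "g x = y" by blast
  from step.hyps(2) obtain s where "sact s y = z \<or> sact s z = y"
    by (auto simp: sact_steps_def)
  then have "sact s y = z \<or> sact_inv s y = z"
    using sact_inv_sact by blast
  then obtain h where "h \<in> basilica" "h y = z"
    using basilica_gens(1,2) by blast
  with g show ?case using basilica_comp[of h g] by (auto intro: bexI[of _ "h \<circ> g"])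
qed

text \<open>Here \<open>a\<close> acts behind a leading 0 as \<open>b\<^sup>2\<close> does on the whole word, and \<open>b\<close> acts there as
  \<open>a\<close> does.\<close>

lemma sact_steps_False:
  assumes "(x, y) \<in> sact_steps\<^sup>*"
  shows "(False ## x, False ## y) \<in> sact_steps\<^sup>*"
proof -
  have gen: "(False ## x, False ## sact s x) \<in> sact_steps\<^sup>*" for s x
  proof (cases s)
    case Ga
    have "(False ## x, True ## sact Ga x) \<in> sact_steps" "(True ## sact Ga x, False ## sact Ga x) \<in> sact_steps"
      using sact_stepI[of "False ## x" Gb] sact_stepI[of "True ## sact Ga x" Gb] by (simp_all add: sact_SCons)
    with Ga show ?thesis by (metis r_into_rtrancl rtrancl_into_rtrancl)
  next
    case Gb
    then show ?thesis
      using sact_stepI[of "False ## x" Ga] by (auto simp: sact_SCons)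
  qed
  show ?thesis
    using assms
  proof (induction rule: rtrancl_induct)
    case (step y z)
    then have "(False ## y, False ## z) \<in> sact_steps\<^sup>*"
      using gen sact_steps_sym by (auto simp: sact_steps_def)
    with step.IH show ?case by (rule rtrancl_trans)
  qed simp
qed

lemma E4_linked_zero: "x \<in> E4 \<Longrightarrow> (x, sconst False) \<in> sact_steps\<^sup>*"
proof (induction rule: E4_induct)
  case zero
  show ?case by (rule rtrancl_refl)
next
  case alternating
  then show ?case
    using sact_steps_sym[OF r_into_rtrancl[OF sact_stepI[of "sconst False" Ga]]]
    by (simp only: sact_zero)
next
  case (SCons c x)
  have "(c ## x, False ## x) \<in> sact_steps\<^sup>*"
    using sact_stepI[of "True ## x" Gb] by (cases c) (auto simp: sact_SCons)
  also have "(False ## x, False ## sconst False) \<in> sact_steps\<^sup>*"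
    by (rule sact_steps_False[OF SCons.IH])
  finally show ?case by (simp only: sconst_False_unfold[symmetric])
qed

lemma basilica_orbit_E4:
  assumes "\<xi> \<in> E4"
  shows "basilica_orbit \<xi> = E4"
proof
  show "basilica_orbit \<xi> \<subseteq> E4"
    using basilica_preserves_E4 assms by (auto simp: basilica_orbit_def)
  show "E4 \<subseteq> basilica_orbit \<xi>"
  proof
    fix x
    assume "x \<in> E4"
    then have "(\<xi>, x) \<in> sact_steps\<^sup>*"
      using E4_linked_zero assms sact_steps_sym by (meson rtrancl_trans)
    then show "x \<in> basilica_orbit \<xi>"
      using sact_steps_basilica by (auto simp: basilica_orbit_def)
  qed
qed


section \<open>Decorations inside the infinite graph\<close>

lemma sact_shift: "True \<in> set w \<Longrightarrow> sact s (w @- x) = act s w @- x"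
  by (induction s w rule: act.induct) (auto simp: sact_SCons)

lemma sact_zeros_shift:
  "sact s (zeros n @- x) = act s (zeros n) @- sact (if even n then s else swap_gen s) x"
proof (induction n arbitrary: s)
  case (Suc n)
  then show ?case by (cases s) (auto simp: zeros_Suc sact_SCons)
qed (simp add: zeros_def)

text \<open>The decoration word \<open>v0\<close> hung at a path vertex \<open>0\<^sup>l1u\<close> goes to \<open>v1u\<close>, where
  \<open>l\<close> is the length of \<open>v\<close>. The same formula at \<open>v = 0\<^sup>l\<close> gives the path vertex
  back, so that it respects the identification made by \<open>deco_vertex\<close>.\<close>

fun place :: "vertex4 \<Rightarrow> bool stream" where
  "place Origin = sconst False"
| "place (Path c n) = axis c n"
| "place (Hang c k n w) = butlast w @- sdrop (length w - 1) (axis c n)"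

lemma place_path_vertex [simp]: "place (path_vertex c n) = axis c n"
  by (simp add: path_vertex_def axis_zero)

lemma deco_words_butlast:
  assumes "w \<in> deco_words k" "k \<ge> 1"
  obtains v where "w = v @ [False]" "length v = k - 1"
proof -
  have w: "length w = k" "True \<in> set w \<longrightarrow> odd_trail w"
    using assms(1) by (simp_all add: deco_words_def)
  with assms(2) have "w \<noteq> []" by auto
  then obtain v c where vc: "w = v @ [c]" by (metis rev_exhaust)
  have "\<not> c" using w(2) by (auto simp: vc odd_trail_snoc)
  moreover have "length v = k - 1" using w(1) vc by auto
  ultimately show ?thesis using that[of v] vc by simp
qed

lemma place_deco_vertex:
  assumes "n \<in> A k" "axis c n = zeros (deco_index c k - 1) @- y"
    and "length v = deco_index c k - 1"
  shows "place (deco_vertex c k n (v @ [False])) = v @- y"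
proof (cases "v @ [False] = zeros (deco_index c k)")
  case True
  moreover have "zeros (deco_index c k - 1) @ [False] = zeros (deco_index c k)"
    using zeros_snoc[of "deco_index c k - 1"] deco_index_pos[of c k] by simp
  ultimately have "v = zeros (deco_index c k - 1)"
    by (metis append_same_eq)
  with True assms(2) show ?thesis by (simp add: deco_vertex_def)
next
  case False
  with assms show ?thesis by (simp add: deco_vertex_def sdrop_shift)
qed

text \<open>If \<open>v\<close> contains a 1, the generator stops inside \<open>v\<close>. Otherwise it is
  \<open>inner_gen\<close> of the index and reaches the end of \<open>v\<close> as \<open>a\<close>, which fixes the last letter
  0 of the decoration word as well as the word \<open>1u\<close>.\<close>

lemma place_deco_edge:
  assumes n: "n \<in> A k" and e: "(s, w) \<in> edges (decoration (deco_index c k))"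
  shows "sact s (place (deco_vertex c k n w)) = place (deco_vertex c k n (act s w))"
proof -
  let ?l = "deco_index c k - 1"
  obtain y where y: "axis c n = zeros ?l @- True ## y"
    using axis_A[OF n] by blast
  have w: "w \<in> deco_words (deco_index c k)" "True \<in> set w \<or> s = inner_gen (deco_index c k)"
    using e unfolding edges_decoration[OF deco_index_pos] by simp_all
  obtain v where v: "w = v @ [False]" "length v = ?l"
    using deco_words_butlast[OF w(1) deco_index_pos] .
  have "act s w = act s v @ [False] \<and> sact s (v @- True ## y) = act s v @- True ## y"
  proof (cases "True \<in> set v")
    case True
    then show ?thesis by (simp add: v(1) act_append sact_shift)
  next
    case False
    then have vz: "v = zeros ?l" using has_True_iff[OF v(2)] by simp
    have "s = inner_gen (Suc ?l)"
      using w(2) False v(1) deco_index_pos[of c k] by simp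
    then have "(if even ?l then s else swap_gen s) = Ga"
      by (simp add: inner_gen_def)
    then show ?thesis
      unfolding v(1) using act_zeros_append[of s ?l "[False]"] sact_zeros_shift[of s ?l "True ## y"]
      by (simp add: vz sact_SCons)
  qed
  then show ?thesis
    using place_deco_vertex[OF n y] v by simp
qed


section \<open>The vertex bijection\<close>

lemma verts_Gamma4:
  "v \<in> verts Gamma4 \<longleftrightarrow> (\<exists>c n. v = path_vertex c n) \<or>
     (\<exists>c k n w. v = Hang c k n w \<and> n \<in> A k \<and> w \<in> deco_words (deco_index c k) \<and> True \<in> set w)"
proof -
  have "deco_vertex c k n w = (if True \<in> set w then Hang c k n w else path_vertex c n)"
    if "w \<in> deco_words (deco_index c k)" for c k n w
    using that has_True_iff[of w "deco_index c k"] by (auto simp: deco_vertex_def deco_words_def)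
  then show ?thesis
    unfolding Gamma4_def using verts_decoration[OF deco_index_pos] by simp metis
qed

lemma path_vertex_in_verts [simp]: "path_vertex c n \<in> verts Gamma4"
  unfolding verts_Gamma4 by blast

lemma deco_vertex_in_verts:
  "n \<in> A k \<Longrightarrow> w \<in> deco_words (deco_index c k) \<Longrightarrow> deco_vertex c k n w \<in> verts Gamma4"
  unfolding Gamma4_def using verts_decoration[OF deco_index_pos] by auto

lemma E4_stl: "x \<in> E4 \<Longrightarrow> stl x \<in> E4"
proof (induction x rule: E4_induct)
  case zero
  show ?case using arg_cong[OF sconst_False_unfold, of stl] E4_sconst by (simp only: stream.sel)
next
  case alternating
  have "stl (cycle [False, True]) = True ## cycle [False, True]"
    using arg_cong[OF alternating_unfold, of stl] by (simp only: stream.sel)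
  then show ?case by (simp only: E4_SCons E4_cycle)
qed simp

lemma E4_sdrop: "x \<in> E4 \<Longrightarrow> sdrop m x \<in> E4"
  by (induction m arbitrary: x) (simp_all add: E4_stl)

lemma axis_in_E4: "axis c n \<in> E4"
proof (induction n rule: int_induct[where k = 0])
  case base
  show ?case unfolding axis_zero by (rule E4_sconst)
next
  case (step1 i)
  then show ?case
    using E4_sact_inv[of "axis c i" "axis_gen c"] sact_inv_sact[of "axis_gen c" "axis c (i + 1)"]
    by (simp add: sact_axis)
next
  case (step2 i)
  then show ?case
    using E4_sact[of "axis c i" "axis_gen c"] sact_axis[of c "i - 1"] by simp
qed

lemma place_in_E4: "place v \<in> E4"
  by (cases v) (simp_all only: place.simps axis_in_E4 E4_sconst E4_shift E4_sdrop)

text \<open>The step that makes \<open>place\<close> surjective onto \<open>E4\<close>. Any letter in front of a vertex of the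
  second path gives a vertex of the first path, and a 0 in front of a vertex of the first path gives
  one of the second. A 1 in front of \<open>0\<^sup>\<omega>\<close> is vertex 1 of the first path; in front of another
  vertex \<open>0\<^bsup>2k\<^esup>1u\<close> of that path it gives \<open>10\<^bsup>2k\<^esup>1u\<close>, which hangs at the vertex
  \<open>0\<^bsup>2k+1\<^esup>1u\<close> of the second. In front of a vertex inside a decoration, the letter lengthens
  the decoration word, and the decoration moves to the other path.\<close>

lemma place_SCons:
  assumes "v \<in> verts Gamma4"
  shows "\<exists>u\<in>verts Gamma4. place u = b ## place v"
proof -
  have path: "\<exists>u\<in>verts Gamma4. place u = b ## x" if "axis c m = b ## x" for c m b x
    using that by (intro bexI[of _ "path_vertex c m"]) simp_all
  have deco: "\<exists>u\<in>verts Gamma4. place u = v @- y"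
    if "n \<in> A k" "axis c n = zeros (deco_index c k - 1) @- y" "length v = deco_index c k - 1"
      "True \<in> set v" "\<not> odd_trail v" for c k n v y
    using that deco_index_pos[of c k]
    by (intro bexI[of _ "deco_vertex c k n (v @ [False])"])
       (auto simp: place_deco_vertex deco_words_def odd_trail_snoc intro!: deco_vertex_in_verts)
  from assms[unfolded verts_Gamma4] show ?thesis
  proof (elim disjE exE conjE)
    fix c n
    assume v: "v = path_vertex c n"
    show ?thesis
    proof (cases c)
      case R1
      consider "\<not> b" | "b" "n = 0" | "b" "n \<noteq> 0" by blast
      then show ?thesis
      proof cases
        case 1
        with v R1 show ?thesis using path[OF axis_SCons(2)[of n]] by simp
      next
        case 2
        then show ?thesis
          using path[OF axis_SCons(1)[of 1]] by (simp add: v axis_zero)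
      next
        case 3
        obtain k where k: "n \<in> A k" using A_cover 3(2) by blast
        obtain y where y: "axis R1 n = zeros (2 * k) @- True ## y"
          using axis_A[OF k, of R1] by auto
        then have "axis R2 n = zeros (deco_index R2 k - 1) @- True ## y"
          by (simp add: axis_SCons(2) zeros_Suc)
        from deco[OF k this, of "True # zeros (2 * k)"] show ?thesis
          using 3 v R1 y by simp
      qed
    next
      case R2
      have "axis R1 (2 * n + (if b then 1 else 0)) = b ## axis R2 n"
        by (subst axis_SCons(1)) simp
      from path[OF this] show ?thesis by (simp add: v R2)
    qed
  next
    fix c k n w
    assume v: "v = Hang c k n w" and n: "n \<in> A k" and w: "w \<in> deco_words (deco_index c k)" "True \<in> set w"
    let ?l = "deco_index c k - 1"
    obtain x where x: "w = x @ [False]" "length x = ?l"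
      using deco_words_butlast[OF w(1) deco_index_pos] .
    have x': "True \<in> set x" "\<not> odd_trail x"
      using w x by (auto simp: deco_words_def odd_trail_snoc)
    obtain y where y: "axis c n = zeros ?l @- True ## y"
      using axis_A[OF n] by blast
    have v_eq: "place v = x @- True ## y"
      by (simp add: v x y sdrop_shift)
    show ?thesis
    proof (cases c)
      case R1
      have "axis R2 n = zeros (deco_index R2 k - 1) @- True ## y"
        using y R1 by (simp add: axis_SCons(2) zeros_Suc)
      from deco[OF n this, of "b # x"] show ?thesis
        using x x' R1 by (simp add: v_eq)
    next
      case R2
      have "axis R1 (2 * n) = zeros (deco_index R1 (Suc k) - 1) @- True ## y"
        using y R2 by (simp add: axis_SCons(1)[of "2 * n"] zeros_Suc)
      from deco[OF _ this, of "b # x"] show ?thesis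
        using n x x' R2 by (simp add: v_eq A_Suc)
    qed
  qed
qed

lemma place_image: "place ` verts Gamma4 = E4"
proof
  show "place ` verts Gamma4 \<subseteq> E4"
    using place_in_E4 by blast
  show "E4 \<subseteq> place ` verts Gamma4"
  proof
    fix x
    assume "x \<in> E4"
    then show "x \<in> place ` verts Gamma4"
    proof (induction rule: E4_induct)
      case zero
      show ?case
        using imageI[OF path_vertex_in_verts, of place R1 0]
        by (simp only: place_path_vertex axis_zero)
    next
      case alternating
      show ?case
        using imageI[OF path_vertex_in_verts, of place R2 "- 1"]
        by (simp only: place_path_vertex axis_minus_one copy.distinct if_False)
    next
      case (SCons b x)
      then obtain v where "v \<in> verts Gamma4" "x = place v" by blast
      with place_SCons[of v b] show ?case by force
    qed
  qed
qed

text \<open>The position \<open>l\<close> of the last 1 whose predecessor among the ones sits at a position of the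
  other parity.\<close>

definition last_break :: "bool stream \<Rightarrow> nat \<Rightarrow> bool" where
  "last_break x l \<longleftrightarrow> x !! l \<and> (\<forall>i\<ge>l. x !! i \<longrightarrow> (even i \<longleftrightarrow> even l)) \<and>
     (\<exists>p<l. x !! p \<and> (even p \<longleftrightarrow> odd l) \<and> (\<forall>i. p < i \<and> i < l \<longrightarrow> \<not> x !! i))"

text \<open>Given two such positions, the 1 before the later one lies at or after the earlier one, where
  all the ones have the same parity.\<close>

lemma last_break_unique:
  assumes "last_break x l" "last_break x m"
  shows "l = m"
proof -
  have "\<not> l < m" if lm: "last_break x l" "last_break x m" for l m
  proof
    assume less: "l < m"
    obtain p where p: "p < m" "x !! p" "even p \<longleftrightarrow> odd m" "\<forall>i. p < i \<and> i < m \<longrightarrow> \<not> x !! i"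
      using lm(2) unfolding last_break_def by blast
    have "x !! l" and later: "\<forall>i\<ge>l. x !! i \<longrightarrow> (even i \<longleftrightarrow> even l)" and "x !! m"
      using lm unfolding last_break_def by blast+
    have "l \<le> p"
      using p(4) less \<open>x !! l\<close> by (meson not_le)
    then have "even p \<longleftrightarrow> even l" "even m \<longleftrightarrow> even l"
      using later p(2) \<open>x !! m\<close> less by simp_all
    with p(3) show False by simp
  qed
  then show ?thesis using assms by (metis linorder_neq_iff)
qed

lemma not_last_break_axis: "\<not> last_break (axis c n) l"
  unfolding last_break_def using axis_snth_parity by metis

text \<open>The last 1 of \<open>v\<close> and the 1 that follows \<open>v\<close> are separated by one zero less than \<open>v0\<close>
  has at its end, hence by an even number of zeros, and from there on the word agrees with a path
  vertex.\<close>

lemma last_break_Hang: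
  assumes n: "n \<in> A k" and w: "w \<in> deco_words (deco_index c k)" "True \<in> set w"
  shows "last_break (place (Hang c k n w)) (deco_index c k - 1)"
proof -
  let ?l = "deco_index c k - 1" and ?x = "place (Hang c k n w)"
  obtain v where v: "w = v @ [False]" "length v = ?l"
    using deco_words_butlast[OF w(1) deco_index_pos] .
  obtain y where y: "axis c n = zeros ?l @- True ## y"
    using axis_A[OF n] by blast
  have x: "?x = v @- True ## y"
    by (simp add: v y sdrop_shift)
  have "?x !! ?l"
    unfolding x by (simp add: v(2))
  moreover have "even i \<longleftrightarrow> even ?l" if "i \<ge> ?l" "?x !! i" for i
  proof -
    have "axis c n !! i"
      using that unfolding x y by (simp add: v(2) shift_snth_ge)
    moreover have "axis c n !! ?l"
      unfolding y by (simp add: shift_snth_ge)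
    ultimately show ?thesis using axis_snth_parity by metis
  qed
  moreover have "\<exists>p<?l. ?x !! p \<and> (even p \<longleftrightarrow> odd ?l) \<and> (\<forall>i. p < i \<and> i < ?l \<longrightarrow> \<not> ?x !! i)"
  proof -
    have "odd_trail w" using w by (simp add: deco_words_def)
    then obtain p where p: "p < length w" "w ! p" "even (length w - p)"
      "\<forall>i<length w. p < i \<longrightarrow> \<not> w ! i"
      using odd_trail_last_one by blast
    have "\<not> w ! ?l" unfolding v(1) v(2)[symmetric] by simp
    with p(2) have "p \<noteq> ?l" by metis
    then have pl: "p < ?l" using p(1) v by simp
    have "even p \<longleftrightarrow> odd ?l"
      using p(1,3) v by auto
    moreover have same: "?x !! i = w ! i" if "i < ?l" for i
      using that unfolding x by (simp add: v nth_append shift_snth_less)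
    moreover have "\<not> ?x !! i" if "p < i" "i < ?l" for i
      using same[of i] p(4) that v by simp
    moreover have "?x !! p" using same[of p] p(2) pl by blast
    ultimately show ?thesis using pl by blast
  qed
  ultimately show ?thesis
    unfolding last_break_def by blast
qed

text \<open>The position of the last break, if there is one, gives the index of the decoration and so its
  path and its level; cutting the word there recovers the rest.\<close>

lemma inj_on_place: "inj_on place (verts Gamma4)"
proof (rule inj_onI)
  have Path_Path: "path_vertex c n = path_vertex d m" if eq: "axis c n = axis d m" for c n d m
  proof (cases "c = d")
    case True
    with eq show ?thesis by (simp add: axis_inject)
  next
    case False
    then have no_one: "\<not> axis c n !! i" for i
      using axis_snth_parity[of c n i] axis_snth_parity[of d m i] eq by (cases c; cases d) auto
    have "n \<notin> A k" for k
      using axis_A[of n k c] no_one[of "deco_index c k - 1"] by auto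
    moreover have "m \<notin> A k" for k
      using axis_A[of m k d] no_one[of "deco_index d k - 1"] eq by auto
    ultimately have "n = 0" "m = 0" using A_cover by blast+
    then show ?thesis by (simp add: path_vertex_def)
  qed
  have Path_Hang: False
    if "axis d m = place (Hang c k n w)" "n \<in> A k" "w \<in> deco_words (deco_index c k)" "True \<in> set w"
    for d m c k n w
    using last_break_Hang[OF that(2-4)] not_last_break_axis that(1) by metis
  have Hang_Hang: "Hang c k n w = Hang d j m u"
    if eq: "place (Hang c k n w) = place (Hang d j m u)"
      and n: "n \<in> A k" and w: "w \<in> deco_words (deco_index c k)" "True \<in> set w"
      and m: "m \<in> A j" and u: "u \<in> deco_words (deco_index d j)" "True \<in> set u"
    for c k n w d j m u
  proof -
    have "deco_index c k - 1 = deco_index d j - 1"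
      using last_break_Hang[OF n w] last_break_Hang[OF m u] eq last_break_unique by metis
    then have idx: "deco_index c k = deco_index d j"
      using deco_index_pos[of c k] deco_index_pos[of d j] by linarith
    then have c: "c = d"
      by (cases c; cases d) (simp_all, presburger+)
    with idx have k: "k = j" by (cases d) simp_all
    let ?l = "deco_index d j - 1"
    obtain v where v: "w = v @ [False]" "length v = ?l"
      using deco_words_butlast[OF w(1) deco_index_pos] idx by metis
    obtain v' where v': "u = v' @ [False]" "length v' = ?l"
      using deco_words_butlast[OF u(1) deco_index_pos] .
    obtain y where y: "axis d n = zeros ?l @- True ## y"
      using axis_A[OF n, of c] idx c by metis
    obtain y' where y': "axis d m = zeros ?l @- True ## y'"
      using axis_A[OF m] by blast
    have shifts: "v @- True ## y = v' @- True ## y'"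
      using eq by (simp add: c v v' y y' sdrop_shift)
    have "v = v'"
      using arg_cong[OF shifts, of "stake ?l"] by (simp add: stake_shift v(2) v'(2))
    moreover from this shifts have "y = y'" by simp
    then have "n = m"
      using y y' axis_inject[of d n m] by simp
    ultimately show ?thesis by (simp add: c k v v')
  qed
  fix x y
  assume "x \<in> verts Gamma4" "y \<in> verts Gamma4" and eq: "place x = place y"
  then show "x = y"
    unfolding verts_Gamma4
    by (elim disjE exE conjE; metis Path_Path Path_Hang Hang_Hang place_path_vertex)
qed

lemma bij_betw_place: "bij_betw place (verts Gamma4) E4"
  by (simp add: bij_betw_def inj_on_place place_image)


section \<open>Every edge is named by a generator and its source\<close>

text \<open>A path edge joins \<open>n\<close> and \<open>n + 1\<close>, and the generator of the path leads from \<open>n + 1\<close> to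
  \<open>n\<close>, as in \<open>sact_axis\<close>; hence \<open>n + 1\<close> is its source.\<close>

fun source :: "edge4 \<Rightarrow> gen \<times> vertex4" where
  "source (PathEdge c n) = (axis_gen c, path_vertex c (n + 1))"
| "source (DecoEdge c k n (s, w)) = (s, deco_vertex c k n w)"

lemma path_vertex_eq_iff: "path_vertex c n = path_vertex d m \<longleftrightarrow> n = m \<and> (n = 0 \<or> c = d)"
  by (auto simp: path_vertex_def)

lemma edges_Gamma4:
  "e \<in> edges Gamma4 \<longleftrightarrow> (\<exists>c n. e = PathEdge c n) \<or>
     (\<exists>c k n s w. e = DecoEdge c k n (s, w) \<and> n \<in> A k \<and> w \<in> deco_words (deco_index c k) \<and>
        (True \<in> set w \<or> s = inner_gen (deco_index c k)))"
  unfolding Gamma4_def using edges_decoration[OF deco_index_pos] by auto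

lemma inner_gen_deco_index: "inner_gen (deco_index c k) = swap_gen (axis_gen c)"
  by (cases c) (simp_all add: inner_gen_def)

text \<open>A path edge and a decoration edge could share their source only at a path vertex
  \<open>n \<noteq> 0\<close> on the path of the decoration, but there the decoration uses the generator other than
  that of the path.\<close>

lemma inj_on_source: "inj_on source (edges Gamma4)"
proof (rule inj_onI)
  have Path_Deco: False
    if "source (PathEdge d m) = source (DecoEdge c k n (s, w))"
      "n \<in> A k" "True \<in> set w \<or> s = inner_gen (deco_index c k)" for d m c k n s w
  proof -
    have s: "s = axis_gen d" and v: "path_vertex d (m + 1) = deco_vertex c k n w"
      using that(1) by simp_all
    have wz: "w = zeros (deco_index c k)"
      using v by (auto simp: deco_vertex_def path_vertex_def split: if_splits)
    have "n \<noteq> 0" using that(2) zero_notin_A by blast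
    with v wz have "d = c" by (auto simp: deco_vertex_def path_vertex_eq_iff)
    moreover have "s = swap_gen (axis_gen c)"
      using that(3) wz by (auto simp: inner_gen_deco_index)
    ultimately show False using s by (cases c) simp_all
  qed
  have Deco_Deco: "DecoEdge c k n (s, w) = DecoEdge d j m (t, u)"
    if eq: "source (DecoEdge c k n (s, w)) = source (DecoEdge d j m (t, u))"
      and n: "n \<in> A k" and m: "m \<in> A j" for c k n s w d j m t u
  proof (cases "w = zeros (deco_index c k)")
    case True
    then have "u = zeros (deco_index d j)" "path_vertex c n = path_vertex d m"
      using eq by (auto simp: deco_vertex_def path_vertex_def split: if_splits)
    moreover from this n have "c = d" "n = m"
      using zero_notin_A by (auto simp: path_vertex_eq_iff)
    moreover from this n m have "k = j" using A_unique by blast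
    ultimately show ?thesis using eq True by simp
  next
    case False
    then show ?thesis
      using eq by (auto simp: deco_vertex_def path_vertex_def split: if_splits)
  qed
  fix e f
  assume "e \<in> edges Gamma4" "f \<in> edges Gamma4" and eq: "source e = source f"
  moreover have "c = d \<and> n = m" if "source (PathEdge c n) = source (PathEdge d m)" for c n d m
    using that by (cases c; cases d) (auto simp: path_vertex_eq_iff)
  ultimately show "e = f"
    unfolding edges_Gamma4
    by (elim disjE exE conjE; metis Path_Deco Deco_Deco)
qed

text \<open>At the common vertex 0 both generators run along paths; at any other path vertex one runs
  along the path and the other into the decoration, and the remaining vertices have both their
  edges in their decoration.\<close>

lemma source_surj:
  assumes "v \<in> verts Gamma4"
  shows "\<exists>e\<in>edges Gamma4. source e = (s, v)"
  using assms[unfolded verts_Gamma4]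
proof (elim disjE exE conjE)
  fix c n
  assume v: "v = path_vertex c n"
  have along: "\<exists>e\<in>edges Gamma4. source e = (axis_gen d, path_vertex d n)" for d
    by (intro bexI[of _ "PathEdge d (n - 1)"]) (simp_all add: edges_Gamma4)
  consider "s = axis_gen c" | "s = swap_gen (axis_gen c)" "n = 0" | "s = swap_gen (axis_gen c)" "n \<noteq> 0"
    by (cases s; cases c) auto
  then show ?thesis
  proof cases
    case 1
    with along v show ?thesis by simp
  next
    case 2
    with along[of R1] along[of R2] v show ?thesis
      by (cases c) (simp_all add: path_vertex_def)
  next
    case 3
    then obtain k where "n \<in> A k" using A_cover by blast
    with 3 v show ?thesis
      by (intro bexI[of _ "DecoEdge c k n (s, zeros (deco_index c k))"])
         (auto simp: edges_Gamma4 inner_gen_deco_index deco_vertex_def)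
  qed
next
  fix c k n w
  assume "v = Hang c k n w" "n \<in> A k" "w \<in> deco_words (deco_index c k)" "True \<in> set w"
  then show ?thesis
    by (intro bexI[of _ "DecoEdge c k n (s, w)"]) (auto simp: edges_Gamma4 deco_vertex_def)
qed

lemma source_in_verts: "e \<in> edges Gamma4 \<Longrightarrow> snd (source e) \<in> verts Gamma4"
  unfolding edges_Gamma4 by (auto intro: deco_vertex_in_verts)

lemma bij_betw_source: "bij_betw source (edges Gamma4) (UNIV \<times> verts Gamma4)"
  unfolding bij_betw_def
proof (intro conjI equalityI subsetI inj_on_source)
  fix p
  assume "p \<in> source ` edges Gamma4"
  then show "p \<in> UNIV \<times> verts Gamma4" using source_in_verts by (auto simp: mem_Times_iff)
next
  fix p :: "gen \<times> vertex4"
  assume "p \<in> UNIV \<times> verts Gamma4"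
  then show "p \<in> source ` edges Gamma4" using source_surj by (metis SigmaE imageI)
qed

lemma ends_Gamma4:
  assumes e: "e \<in> edges Gamma4" and src: "source e = (s, v)"
  shows "\<exists>u\<in>verts Gamma4. ends Gamma4 e = Upair v u \<and> place u = sact s (place v)"
proof -
  consider (Path) c n where "e = PathEdge c n"
    | (Deco) c k n t w where "e = DecoEdge c k n (t, w)" "n \<in> A k" "w \<in> deco_words (deco_index c k)"
        "True \<in> set w \<or> t = inner_gen (deco_index c k)"
    using e unfolding edges_Gamma4 by blast
  then show ?thesis
  proof cases
    case Path
    with src show ?thesis
      by (intro bexI[of _ "path_vertex c n"]) (auto simp: Gamma4_def sact_axis)
  next
    case Deco
    have edge: "(t, w) \<in> edges (decoration (deco_index c k))"
      using Deco(3,4) unfolding edges_decoration[OF deco_index_pos] by simp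
    then have "act t w \<in> verts (decoration (deco_index c k))"
      by (auto simp: decoration_def induced_def Gamma_fin_def schreier_def)
    then have "deco_vertex c k n (act t w) \<in> verts Gamma4"
      using Deco(2) deco_vertex_in_verts unfolding verts_decoration[OF deco_index_pos] by blast
    then show ?thesis
      using src Deco(1) place_deco_edge[OF Deco(2) edge]
      by (intro bexI[of _ "deco_vertex c k n (act t w)"]) (auto simp: Gamma4_def ends_decoration)
  qed
qed

theorem theorem4p6:
  fixes \<xi> :: "bool stream"
  assumes "\<xi> \<in> E4"
  shows "mgraph_iso (Gamma_inf \<xi>) Gamma4"
proof -
  have Gamma: "verts (Gamma_inf \<xi>) = E4" "edges (Gamma_inf \<xi>) = UNIV \<times> E4"
    "ends (Gamma_inf \<xi>) (s, x) = Upair x (sact s x)" for s x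
    by (simp_all add: Gamma_inf_def schreier_def basilica_orbit_E4[OF assms])
  define \<phi> where "\<phi> = inv_into (verts Gamma4) place"
  define \<psi> where "\<psi> = inv_into (edges Gamma4) source \<circ> map_prod id \<phi>"
  have \<phi>: "bij_betw \<phi> E4 (verts Gamma4)"
    unfolding \<phi>_def by (rule bij_betw_inv_into[OF bij_betw_place])
  have \<phi>_place: "\<phi> (place v) = v" if "v \<in> verts Gamma4" for v
    unfolding \<phi>_def using that inj_on_place by simp
  have place_\<phi>: "place (\<phi> x) = x" if "x \<in> E4" for x
    unfolding \<phi>_def using that by (simp add: f_inv_into_f place_image)
  have "bij_betw (map_prod id \<phi>) (UNIV \<times> E4) (UNIV \<times> verts Gamma4)"
    by (rule bij_betw_map_prod[OF bij_betw_id \<phi>])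
  then have \<psi>: "bij_betw \<psi> (UNIV \<times> E4) (edges Gamma4)"
    unfolding \<psi>_def by (rule bij_betw_trans[OF _ bij_betw_inv_into[OF bij_betw_source]])
  have "ends Gamma4 (\<psi> (s, x)) = map_uprod \<phi> (Upair x (sact s x))" if x: "x \<in> E4" for s x
  proof -
    have "\<phi> x \<in> verts Gamma4" using \<phi> x by (rule bij_betwE[THEN bspec])
    then have "source (\<psi> (s, x)) = (s, \<phi> x)"
      using bij_betw_source by (simp add: \<psi>_def bij_betw_inv_into_right)
    moreover have "\<psi> (s, x) \<in> edges Gamma4" using \<psi> x by (auto dest: bij_betwE)
    ultimately obtain u where u: "u \<in> verts Gamma4" "ends Gamma4 (\<psi> (s, x)) = Upair (\<phi> x) u"
      and "place u = sact s (place (\<phi> x))"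
      using ends_Gamma4 by blast
    then have "u = \<phi> (sact s x)"
      using \<phi>_place[OF u(1)] place_\<phi>[OF x] by simp
    with u(2) show ?thesis by simp
  qed
  then show ?thesis
    unfolding mgraph_iso_def using \<phi> \<psi> by (intro exI[of _ \<phi>] exI[of _ \<psi>]) (auto simp: Gamma)
qed

end
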